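(* Let $n=2^k$ with $k\in\{0,1,2,\dots\}$, let $f:(0,\infty)\to\mathbb{C}$ be a measurable function and let $y>0$. Then $$\mathcal{L}_n\{\mathcal{L}_{2n}\{f(x);u\};y\}=\frac{\sqrt{\pi}}{2n}\int_0^\infty x^{n-1}f(x)\exp\!\Big(\frac14\frac{y^{2n}}{x^{2n}}\Big)\operatorname{erfc}\!\Big(\frac12\frac{y^n}{x^n}\Big)dx,$$ provided that the integrals involved converge absolutely. Here the outer transform on the left is applied to the function $u\mapsto\mathcal{L}_{2n}\{f(x);u\}$ and evaluated at $y$.
   Context: For $n=2^k$, $k\in\{0,1,2,\dots\}$, a function $f$ on $(0,\infty)$ and $y>0$, define $$\mathcal{L}_n\{f(x);y\}=\int_0^\infty x^{n-1}\exp(-y^nx^n)f(x)\,dx,\qquad \mathcal{L}_{2n}\{f(x);y\}=\int_0^\infty x^{2n-1}\exp(-y^{2n}x^{2n})f(x)\,dx.$$ In the notation $\mathcal{T}\{f(x);y\}$, the variable $x$ is the dummy variable of the function being transformed and $y$ is the point at which the transform is evaluated. The complementary error function is $\operatorname{erfc}(s)=\frac{2}{\sqrt{\pi}}\int_s^\infty e^{-t^2}\,dt$. *)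

theory Defs
  imports "HOL-Analysis.Analysis"
begin

text \<open>
  The transform is defined for an arbitrary exponent, so that the two transforms of exponents
  \<open>n\<close> and \<open>2 * n\<close> are instances of a single definition. A function on \<open>(0,\<infinity>)\<close> is a function on
  the reals of which only the values on \<open>{0<..}\<close> matter. The Bochner integral exists exactly when
  the integrand is absolutely integrable, so absolute convergence is \<open>set_integrable\<close>; the
  integral of a non-integrable function is 0. The exponent \<open>n - 1\<close> is a truncated subtraction and
  is meant for \<open>n \<ge> 1\<close>.
\<close>

definition ltrans_integrand :: "nat \<Rightarrow> (real \<Rightarrow> complex) \<Rightarrow> real \<Rightarrow> real \<Rightarrow> complex" where
  "ltrans_integrand n f y x = of_real (x ^ (n - 1) * exp (- (y ^ n * x ^ n))) * f x"

definition ltrans_converges :: "nat \<Rightarrow> (real \<Rightarrow> complex) \<Rightarrow> real \<Rightarrow> bool" where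
  "ltrans_converges n f y \<longleftrightarrow> set_integrable lebesgue {0<..} (ltrans_integrand n f y)"

definition ltrans :: "nat \<Rightarrow> (real \<Rightarrow> complex) \<Rightarrow> real \<Rightarrow> complex" where
  "ltrans n f y = (LINT x:{0<..}|lebesgue. ltrans_integrand n f y x)"

definition erfc :: "real \<Rightarrow> real" where
  "erfc s = 2 / sqrt pi * (LINT t:{s..}|lebesgue. exp (- (t\<^sup>2)))"

end

theory Submission
  imports Defs "HOL-Probability.Distributions"
begin

text \<open>
  Inserting the definition of the inner transform and exchanging the order of integration leaves,
  for each \<open>x\<close>, the integral of \<open>u ^ (n - 1) * exp (- (y ^ n * u ^ n) - u ^ (2 * n) * x ^ (2 * n))\<close>
  over \<open>u\<close>. Completing the square with the substitution \<open>t = x ^ n * u ^ n + y ^ n / (2 * x ^ n)\<close>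
  turns it into a Gaussian tail. The kernel is positive, so the exchange is justified by Tonelli and
  the absolute convergence of the right-hand side.
\<close>

text \<open>Sets of \<open>M\<close> stay measurable in the completion with unchanged measure, so
  the same countable cover by sets of finite measure works. This makes Fubini applicable to
  \<open>lebesgue\<close>, the completion of \<open>lborel\<close>.\<close>

lemma sigma_finite_measure_completion:
  assumes "sigma_finite_measure M"
  shows "sigma_finite_measure (completion M)"
proof -
  obtain A where A: "countable A" "A \<subseteq> sets M" "\<Union>A = space M" "\<forall>a\<in>A. emeasure M a \<noteq> \<infinity>"
    using sigma_finite_measure.sigma_finite_countable[OF assms] by blast
  show ?thesis
    by standard (use A in \<open>auto intro!: exI[of _ A] simp: subset_iff\<close>)
qed

lemma set_integrable_gaussian_tail:
  fixes s :: real
  assumes "s \<ge> 0"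
  shows "set_integrable lebesgue {s<..} (\<lambda>t. exp (- t\<^sup>2))"
proof -
  have "set_integrable lborel {0..} (\<lambda>t::real. exp (- t\<^sup>2))"
    using gaussian_moment_0 by (auto simp: set_integrable_def has_bochner_integral_iff)
  then have "set_integrable lebesgue {0..} (\<lambda>t::real. exp (- t\<^sup>2))"
    unfolding set_integrable_def by (subst integrable_completion) auto
  then show ?thesis
    by (rule set_integrable_subset) (use assms in auto)
qed

text \<open>A point is a null set, so the closed ray of \<open>erfc\<close> may be opened. The open
  ray is the image of \<open>{0<..}\<close> under the later substitution, and the gauge integral is
  the one used by the change of variables theorem.\<close>

lemma erfc_eq_integral:
  assumes "s \<ge> 0"
  shows "integral {s<..} (\<lambda>t. exp (- t\<^sup>2)) = sqrt pi / 2 * erfc s"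
proof -
  have "(LINT t:{s..}|lebesgue. exp (- (t\<^sup>2))) = (LINT t:{s<..}|lebesgue. exp (- (t\<^sup>2)))"
    by (rule set_integral_discrete_difference[where X = "{s}"]) auto
  also have "\<dots> = integral {s<..} (\<lambda>t. exp (- t\<^sup>2))"
    by (rule set_lebesgue_integral_eq_integral(2)[OF set_integrable_gaussian_tail[OF assms]])
  finally show ?thesis
    by (simp add: erfc_def)
qed

lemma image_monom_add_Ioi:
  fixes a s :: real
  assumes "n > 0" "a > 0"
  shows "(\<lambda>u. a * u ^ n + s) ` {0<..} = {s<..}"
proof (intro equalityI subsetI)
  fix t assume "t \<in> {s<..}"
  then have "t = a * root n ((t - s) / a) ^ n + s" "root n ((t - s) / a) > 0"
    using assms by (simp_all add: real_root_pow_pos)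
  then show "t \<in> (\<lambda>u. a * u ^ n + s) ` {0<..}"
    by (intro image_eqI[of _ _ "root n ((t - s) / a)"]) auto
qed (use assms in auto)

text \<open>Up to the constant \<open>n * x ^ n\<close>, the factor \<open>u ^ (n - 1)\<close> is
  the derivative of the substitution. That constant accounts for \<open>1 / n\<close> and for the
  division by \<open>x ^ n\<close> in the value; \<open>sqrt pi / 2\<close> is the normalisation of
  \<open>erfc\<close>.\<close>

lemma exp_monom_integral:
  fixes x y :: real
  assumes "n > 0" "x > 0" "y > 0"
  defines "h \<equiv> \<lambda>u. u ^ (n - 1) * exp (- (y ^ n * u ^ n)) * exp (- (u ^ (2 * n) * x ^ (2 * n)))"
  shows "set_integrable lebesgue {0<..} h"
    and "(LINT u:{0<..}|lebesgue. h u) =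
      sqrt pi / (2 * real n) * (exp (1 / 4 * (y ^ (2 * n) / x ^ (2 * n))) * erfc (1 / 2 * (y ^ n / x ^ n)))
        / x ^ n"
proof -
  \<comment> \<open>The shift for which the cross term \<open>2 * x ^ n * u ^ n * s\<close> of the
    square \<open>(g u)\<^sup>2\<close> equals \<open>y ^ n * u ^ n\<close>.\<close>
  define s where "s = 1 / 2 * (y ^ n / x ^ n)"
  define g where "g = (\<lambda>u. x ^ n * u ^ n + s)"
  define g' where "g' = (\<lambda>u. x ^ n * (real n * u ^ (n - 1)))"
  \<comment> \<open>Collects \<open>exp (s\<^sup>2)\<close>, left over from completing the square,
    and the reciprocal of the constant factor of \<open>g'\<close>.\<close>
  define c where "c = exp (s\<^sup>2) / (real n * x ^ n)"
  have s: "s \<ge> 0" "s\<^sup>2 = 1 / 4 * (y ^ (2 * n) / x ^ (2 * n))"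
    using assms by (simp_all add: s_def power_mult_distrib power_divide power_even_eq)
  have inj: "inj_on g {0<..}"
    using assms by (auto simp: inj_on_def g_def power_eq_iff_eq_base)
  have deriv: "(g has_field_derivative g' u) (at u within {0<..})" for u
    unfolding g_def g'_def by (auto intro!: derivative_eq_intros)
  have img: "g ` {0<..} = {s<..}"
    unfolding g_def using assms by (intro image_monom_add_Ioi) auto
  \<comment> \<open>Change of variables is an equivalence: integrability and value, both known on
    the tail \<open>{s<..}\<close>, are pulled back together to \<open>{0<..}\<close>.\<close>
  have "(\<lambda>u. \<bar>g' u\<bar> * exp (- (g u)\<^sup>2)) absolutely_integrable_on {0<..} \<and>
    integral {0<..} (\<lambda>u. \<bar>g' u\<bar> * exp (- (g u)\<^sup>2)) = sqrt pi / 2 * erfc s"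
    by (subst has_absolute_integral_change_of_variables_1'[where f = "\<lambda>t. exp (- t\<^sup>2)"])
       (use deriv inj img set_integrable_gaussian_tail erfc_eq_integral s in auto)
  then have int: "set_integrable lebesgue {0<..} (\<lambda>u. \<bar>g' u\<bar> * exp (- (g u)\<^sup>2))"
    and val: "(LINT u:{0<..}|lebesgue. \<bar>g' u\<bar> * exp (- (g u)\<^sup>2)) = sqrt pi / 2 * erfc s"
    by (simp_all only: set_lebesgue_integral_eq_integral(2))
  have h: "h u = c * (\<bar>g' u\<bar> * exp (- (g u)\<^sup>2))" if "u \<in> {0<..}" for u
  proof -
    have "(g u)\<^sup>2 = u ^ (2 * n) * x ^ (2 * n) + y ^ n * u ^ n + s\<^sup>2"
      using assms unfolding g_def s_def
      by (simp add: power2_sum power_mult_distrib power_even_eq)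
    then have "exp (- (y ^ n * u ^ n)) * exp (- (u ^ (2 * n) * x ^ (2 * n))) = exp (s\<^sup>2) * exp (- (g u)\<^sup>2)"
      by (simp flip: exp_add)
    then show ?thesis
      using that assms by (simp add: h_def c_def g'_def mult.assoc)
  qed
  show "set_integrable lebesgue {0<..} h"
    using set_integrable_mult_right[OF int, of c] h by (subst set_integrable_cong) auto
  have "(LINT u:{0<..}|lebesgue. h u) = (LINT u:{0<..}|lebesgue. c * (\<bar>g' u\<bar> * exp (- (g u)\<^sup>2)))"
    by (rule set_lebesgue_integral_cong) (use h in auto)
  also have "\<dots> = c * (sqrt pi / 2 * erfc s)"
    by (simp only: set_integral_mult_right val)
  finally show "(LINT u:{0<..}|lebesgue. h u) =
      sqrt pi / (2 * real n) * (exp (1 / 4 * (y ^ (2 * n) / x ^ (2 * n))) * erfc (1 / 2 * (y ^ n / x ^ n)))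
        / x ^ n"
    unfolding s_def[symmetric] s(2)[symmetric] by (simp add: c_def mult_ac)
qed

theorem lemma1:
  fixes k n :: nat and f :: "real \<Rightarrow> complex" and y :: real
  assumes "n = 2 ^ k"
    and "f \<in> borel_measurable (lebesgue_on {0<..})"
    and "y > 0"
    and "\<And>u. u > 0 \<Longrightarrow> ltrans_converges (2 * n) f u"
    and "ltrans_converges n (ltrans (2 * n) f) y"
    and "set_integrable lebesgue {0<..}
      (\<lambda>x. of_real (x ^ (n - 1)) * f x
        * of_real (exp (1 / 4 * (y ^ (2 * n) / x ^ (2 * n))) * erfc (1 / 2 * (y ^ n / x ^ n))))"
  shows "ltrans n (ltrans (2 * n) f) y =
    of_real (sqrt pi / (2 * real n)) *
    (LINT x:{0<..}|lebesgue. of_real (x ^ (n - 1)) * f x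
        * of_real (exp (1 / 4 * (y ^ (2 * n) / x ^ (2 * n))) * erfc (1 / 2 * (y ^ n / x ^ n))))"
proof -
  interpret leb: sigma_finite_measure "lebesgue :: real measure"
    by (rule sigma_finite_measure_completion[OF sigma_finite_lborel])
  interpret P: pair_sigma_finite "lebesgue :: real measure" "lebesgue :: real measure" ..
  have n: "n > 0" using assms(1) by simp
  \<comment> \<open>Both half-line restrictions become indicators, in x inside \<open>g\<close> and
    in u inside \<open>h\<close>, so that Fubini can be applied on the product of two whole
    lines.\<close>
  define g where "g = (\<lambda>x. indicator {0<..} x *\<^sub>R f x)"
  define h where "h = (\<lambda>x u. indicator {0<..} u * (u ^ (n - 1) * exp (- (y ^ n * u ^ n))
    * exp (- (u ^ (2 * n) * x ^ (2 * n)))) :: real)"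
  define H where "H = (\<lambda>x u. g x * of_real (x ^ (2 * n - 1) * h x u))"
  define w where "w = (\<lambda>x. exp (1 / 4 * (y ^ (2 * n) / x ^ (2 * n))) * erfc (1 / 2 * (y ^ n / x ^ n)))"
  define C where "C = sqrt pi / (2 * real n)"
  define R where "R = (\<lambda>x. indicator {0<..} x *\<^sub>R (of_real (x ^ (n - 1)) * f x * of_real (w x)))"
  have R: "integrable lebesgue R"
    using assms(6) by (simp add: R_def w_def set_integrable_def)
  have g_meas [measurable]: "g \<in> borel_measurable lebesgue"
    unfolding g_def using assms(2) by (subst (asm) borel_measurable_restrict_space_iff) auto
  \<comment> \<open>Passes from the Lebesgue to the Borel sigma-algebra on the target, which makes
    the two projections Borel-valued below.\<close>
  have id_meas [measurable]: "(\<lambda>x::real. x) \<in> borel_measurable lebesgue"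
    by (rule measurable_completion) simp
  have H_meas: "case_prod H \<in> borel_measurable (lebesgue \<Otimes>\<^sub>M lebesgue)"
  proof -
    have [measurable]: "(fst :: real \<times> real \<Rightarrow> real) \<in> borel_measurable (lebesgue \<Otimes>\<^sub>M lebesgue)"
      "(snd :: real \<times> real \<Rightarrow> real) \<in> borel_measurable (lebesgue \<Otimes>\<^sub>M lebesgue)"
      by (rule measurable_compose[OF measurable_fst id_meas],
          rule measurable_compose[OF measurable_snd id_meas])
    have [measurable]: "(\<lambda>p. g (fst p)) \<in> borel_measurable (lebesgue \<Otimes>\<^sub>M (lebesgue :: real measure))"
      by (rule measurable_compose[OF measurable_fst g_meas])
    show ?thesis
      unfolding H_def h_def case_prod_beta by measurable
  qed
  have h: "integrable lebesgue (h x)" "(LINT u|lebesgue. h x u) = C * w x / x ^ n" if "x > 0" for x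
    using exp_monom_integral[OF n that \<open>y > 0\<close>]
    by (simp_all add: h_def C_def w_def set_integrable_def set_lebesgue_integral_def)
  have g0: "g x = 0" if "\<not> x > 0" for x
    using that by (simp add: g_def)
  \<comment> \<open>The truncated exponents add up because \<open>n\<close> is positive. The factor
    \<open>x ^ n\<close> split off here cancels the division by \<open>x ^ n\<close> in the inner
    integral.\<close>
  have pow: "x ^ (2 * n - 1) = x ^ (n - 1) * x ^ n" for x :: real
    using n by (simp add: mult_2 flip: power_add)
  have H_int: "integrable lebesgue (H x)" for x
    using h(1)[of x] g0[of x] by (cases "x > 0") (auto simp: H_def)
  have H_val: "(LINT u|lebesgue. H x u) = of_real C * R x" for x
  proof (cases "x > 0")
    case True
    then have "x ^ (2 * n - 1) * (LINT u|lebesgue. h x u) = C * (x ^ (n - 1) * w x)"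
      unfolding h(2)[OF True] pow by simp
    moreover have "(LINT u|lebesgue. H x u) = g x * of_real (x ^ (2 * n - 1) * (LINT u|lebesgue. h x u))"
      by (simp add: H_def)
    ultimately show ?thesis
      using True by (simp add: R_def g_def)
  qed (simp add: H_def R_def g0)
  have h_nonneg: "h x u \<ge> 0" for x u
    by (simp add: h_def indicator_def)
  \<comment> \<open>For fixed x, \<open>H x\<close> is a complex constant times the nonnegative
    \<open>h x\<close>, so norm and integral over u commute. The integrated norm is thus that of the
    right-hand integrand, integrable by \<open>R\<close>.\<close>
  have H_norm: "(LINT u|lebesgue. norm (H x u)) = norm (of_real C * R x)" for x
  proof -
    have "(LINT u|lebesgue. norm (H x u)) = norm (g x) * \<bar>x ^ (2 * n - 1)\<bar> * (LINT u|lebesgue. h x u)"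
      using h_nonneg by (simp add: H_def norm_mult norm_power power_abs mult.assoc)
    also have "\<dots> = norm (g x * of_real (x ^ (2 * n - 1) * (LINT u|lebesgue. h x u)))"
      using h_nonneg by (simp add: norm_mult norm_power power_abs integral_nonneg)
    also have "\<dots> = norm (LINT u|lebesgue. H x u)"
      by (simp add: H_def)
    finally show ?thesis
      by (simp add: H_val)
  qed
  have "integrable (lebesgue \<Otimes>\<^sub>M lebesgue) (case_prod H)"
  proof (rule P.Fubini_integrable[OF H_meas])
    show "integrable lebesgue (\<lambda>x. LINT u|lebesgue. norm (case_prod H (x, u)))"
      using R by (simp add: H_norm)
  qed (use H_int in simp)
  then have "(LINT u|lebesgue. LINT x|lebesgue. H x u) = (LINT x|lebesgue. LINT u|lebesgue. H x u)"
    by (rule P.Fubini_integral)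
  also have "\<dots> = of_real C * (LINT x|lebesgue. R x)"
    by (simp add: H_val)
  also have "(LINT u|lebesgue. LINT x|lebesgue. H x u) = ltrans n (ltrans (2 * n) f) y"
    unfolding ltrans_def[of n] set_lebesgue_integral_def
  proof (rule Bochner_Integration.integral_cong[OF refl])
    fix u :: real
    define a where "a = indicator {0<..} u * (u ^ (n - 1) * exp (- (y ^ n * u ^ n)))"
    \<comment> \<open>The part of the kernel that depends on u alone is a constant for the integral
      over x; what remains is the integrand of the inner transform. For \<open>u \<le> 0\<close>
      both sides vanish since \<open>a = 0\<close>.\<close>
    have "H x u = of_real a * (indicator {0<..} x *\<^sub>R ltrans_integrand (2 * n) f u x)" for x
      by (simp add: H_def h_def g_def a_def ltrans_integrand_def indicator_def)
    then show "(LINT x|lebesgue. H x u) =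
        indicator {0<..} u *\<^sub>R ltrans_integrand n (ltrans (2 * n) f) y u"
      by (simp add: ltrans_def set_lebesgue_integral_def a_def ltrans_integrand_def[of n]
          scaleR_conv_of_real)
  qed
  finally show ?thesis
    by (simp add: C_def R_def w_def set_lebesgue_integral_def)
qed

end
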